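(* Let $\kappa<0$ and $u_0<0$, and let $u=u(\cdot;u_0):\mathbb{R}\to\mathbb{R}$ be the solution of $$\frac{u''(r)}{(1-u'(r)^2)^{3/2}}=\kappa\,u(r),\qquad u(0)=u_0,\quad u'(0)=0,\quad |u'|<1 .$$ Then $u$ is a periodic function that vanishes on an infinite discrete set of points. The inflection points of $u$ are exactly its zeros. Moreover, $u_0\le u(r)\le -u_0$ for all $r$; both values $u_0$ and $-u_0$ are attained, and the points where $u$ takes one of these two values are exactly the critical points of $u$.
   Context: The initial value problem has a unique solution, whose maximal interval of definition is $\mathbb{R}$. *)

theory Defs
  imports "HOL-Analysis.Analysis" "HOL-Library.Periodic_Fun"
begin

text \<open>
  Global classical solutions of the initial value problem.  Differentiability of \<open>u\<close> and of its
  derivative is required explicitly because \<^const>\<open>deriv\<close> is total.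
\<close>

definition is_solution :: "real \<Rightarrow> real \<Rightarrow> (real \<Rightarrow> real) \<Rightarrow> bool" where
  "is_solution \<kappa> u0 u \<longleftrightarrow>
     u differentiable_on UNIV \<and> deriv u differentiable_on UNIV \<and>
     (\<forall>r. \<bar>deriv u r\<bar> < 1) \<and>
     (\<forall>r. deriv (deriv u) r / (1 - (deriv u r)\<^sup>2) powr (3/2) = \<kappa> * u r) \<and>
     u 0 = u0 \<and> deriv u 0 = 0"

definition strictly_convex_on :: "real set \<Rightarrow> (real \<Rightarrow> real) \<Rightarrow> bool" where
  "strictly_convex_on S f \<longleftrightarrow> convex S \<and>
     (\<forall>x\<in>S. \<forall>y\<in>S. \<forall>s>0. \<forall>t>0. x \<noteq> y \<and> s + t = 1 \<longrightarrow> f (s * x + t * y) < s * f x + t * f y)"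

definition strictly_concave_on :: "real set \<Rightarrow> (real \<Rightarrow> real) \<Rightarrow> bool" where
  "strictly_concave_on S f \<longleftrightarrow> strictly_convex_on S (\<lambda>x. - f x)"

text \<open>
  An inflection point is a point where the graph changes concavity.  It is not defined by
  \<open>f'' = 0\<close>, which is only a necessary condition.  Strictness keeps the points of
  an affine piece from counting as inflection points.
\<close>

definition inflection_point :: "(real \<Rightarrow> real) \<Rightarrow> real \<Rightarrow> bool" where
  "inflection_point f x \<longleftrightarrow> isCont f x \<and>
     (\<exists>e>0. strictly_convex_on {x - e<..<x} f \<and> strictly_concave_on {x<..<x + e} f \<or>
            strictly_concave_on {x - e<..<x} f \<and> strictly_convex_on {x<..<x + e} f)"

definition critical_point :: "(real \<Rightarrow> real) \<Rightarrow> real \<Rightarrow> bool" where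
  "critical_point f x \<longleftrightarrow> (f has_real_derivative 0) (at x)"

end

theory Submission
  imports Defs
begin

text \<open>
  The proof passes to the relativistic momentum \<open>w = u' / sqrt (1 - u'\<^sup>2)\<close>.  The substitution is
  inverted by \<open>u' = w / sqrt (1 + w\<^sup>2)\<close>, and the equation becomes the autonomous system
  \<open>u' = w / sqrt (1 + w\<^sup>2)\<close>, \<open>w' = \<kappa> u\<close>, whose right-hand side is globally Lipschitz.  Hence a
  trajectory is determined by its state at one instant (\<open>flow_unique\<close>), and each symmetry of the
  system that fixes a state becomes a symmetry of the trajectory through it.

  Reflection of time fixes the state at \<open>0\<close>, where \<open>w = 0\<close>, so \<open>u\<close> is even.  The solution vanishes
  at some \<open>a > 0\<close>: as long as \<open>u < 0\<close> the momentum grows, so \<open>u\<close> would otherwise rise at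
  a speed bounded away from \<open>0\<close> (\<open>flow_has_zero\<close>).  Reflection of time combined with a change of
  sign fixes the state at \<open>a\<close>, so the graph is symmetric about \<open>(a, 0)\<close>.  The two reflections
  compose to \<open>u (r + 2 * a) = - u r\<close>.  This gives the period \<open>4 * a\<close>, infinitely many zeros, and
  the value \<open>- u0\<close> at \<open>2 * a\<close>.

  The energy \<open>sqrt (1 + w\<^sup>2) - \<kappa> / 2 * u\<^sup>2\<close> is constant.  Comparison with time \<open>0\<close> shows that
  \<open>u\<^sup>2 \<le> u0\<^sup>2\<close>, with equality exactly where \<open>w = 0\<close>, that is, at the critical points.  In
  particular \<open>w\<close> does not vanish at a zero of \<open>u\<close>, so \<open>u\<close> changes sign there; zeros are therefore
  isolated.  Finally \<open>w' = \<kappa> u\<close> makes \<open>u\<close> strictly convex on intervals where it is negative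
  and strictly concave where it is positive, so the concavity changes exactly at the zeros.
\<close>

section \<open>Velocity as a function of momentum\<close>

text \<open>
  Inverse of \<open>v \<mapsto> v / sqrt (1 - v\<^sup>2)\<close>, a bijection from \<open>(-1, 1)\<close> to the reals.
\<close>

definition velocity :: "real \<Rightarrow> real" where
  "velocity p = p / sqrt (1 + p\<^sup>2)"

lemma DERIV_velocity:
  "(velocity has_real_derivative 1 / sqrt (1 + p\<^sup>2) ^ 3) (at p)"
proof -
  have pos: "1 + p\<^sup>2 > 0"
    by (simp add: add_pos_nonneg)
  define s where "s = sqrt (1 + p\<^sup>2)"
  have s: "s > 0" "s\<^sup>2 = 1 + p\<^sup>2"
    using pos by (auto simp: s_def)
  have "((\<lambda>p. p / sqrt (1 + p\<^sup>2)) has_real_derivative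
      (1 * s - p * ((0 + 2 * p) * (inverse s / 2))) / (s * s)) (at p)"
    unfolding s_def using pos
    by (auto intro!: derivative_eq_intros simp: power2_eq_square divide_simps)
  moreover have "(1 * s - p * ((0 + 2 * p) * (inverse s / 2))) / (s * s) = (s\<^sup>2 - p\<^sup>2) / s ^ 3"
    using s(1) by (simp add: field_simps power2_eq_square power3_eq_cube)
  moreover have "s\<^sup>2 - p\<^sup>2 = 1"
    using s(2) by simp
  ultimately show ?thesis
    unfolding velocity_def s_def by simp
qed

lemma velocity_strict_mono: "strict_mono velocity"
proof (rule strict_monoI)
  fix p q :: real
  assume "p < q"
  have "\<exists>y. (velocity has_real_derivative y) (at x) \<and> 0 < y" for x
    using DERIV_velocity[of x] by (intro exI conjI) (auto simp: add_pos_nonneg)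
  then show "velocity p < velocity q"
    using DERIV_pos_imp_increasing[OF \<open>p < q\<close>] by blast
qed

lemma velocity_0 [simp]: "velocity 0 = 0"
  by (simp add: velocity_def)

lemma velocity_minus [simp]: "velocity (- p) = - velocity p"
  by (simp add: velocity_def)

lemma velocity_eq_0_iff [simp]: "velocity p = 0 \<longleftrightarrow> p = 0"
  using strict_mono_eq[OF velocity_strict_mono, of p 0] by simp

lemma velocity_pos_iff [simp]: "0 < velocity p \<longleftrightarrow> 0 < p"
  using strict_mono_less[OF velocity_strict_mono, of 0 p] by simp

text \<open>
  The derivative of \<open>velocity\<close> lies in \<open>(0, 1]\<close>.  The resulting Lipschitz bound holds on the whole
  line, in contrast to the right-hand side \<open>\<kappa> u (1 - u'\<^sup>2) powr (3/2)\<close> of the original equation,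
  which makes sense only for \<open>\<bar>u'\<bar> < 1\<close>.
\<close>

lemma velocity_nonexpansive: "\<bar>velocity p - velocity q\<bar> \<le> \<bar>p - q\<bar>"
proof -
  have deriv_le_1: "norm (1 / sqrt (1 + x\<^sup>2) ^ 3) \<le> 1" for x :: real
  proof -
    have "1 \<le> sqrt (1 + x\<^sup>2) ^ 3"
      by (intro one_le_power) simp
    then have "1 / sqrt (1 + x\<^sup>2) ^ 3 \<le> 1" "0 \<le> 1 / sqrt (1 + x\<^sup>2) ^ 3"
      by (metis divide_le_eq_1 less_le_trans zero_less_one, metis divide_nonneg_nonneg order_trans zero_le_one)
    then show ?thesis
      by (simp only: real_norm_def abs_of_nonneg)
  qed
  have "norm (velocity p - velocity q) \<le> 1 * norm (p - q)"
    using DERIV_velocity deriv_le_1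
    by (intro field_differentiable_bound[where S = UNIV and f' = "\<lambda>x. 1 / sqrt (1 + x\<^sup>2) ^ 3"]) auto
  then show ?thesis by simp
qed

section \<open>The autonomous first-order system\<close>

definition is_flow :: "real \<Rightarrow> (real \<Rightarrow> real) \<Rightarrow> (real \<Rightarrow> real) \<Rightarrow> bool" where
  "is_flow \<kappa> u w \<longleftrightarrow>
     (\<forall>r. (u has_real_derivative velocity (w r)) (at r) \<and> (w has_real_derivative \<kappa> * u r) (at r))"

text \<open>
  With \<open>s = sqrt (1 - v\<^sup>2)\<close> the quotient rule gives \<open>(v / s)' = v' (s\<^sup>2 + v\<^sup>2) / s ^ 3 = v' / s ^ 3\<close>,
  which is the left-hand side of the second-order equation.
\<close>

lemma solution_imp_flow:
  assumes "is_solution \<kappa> u0 u"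
  obtains w where "is_flow \<kappa> u w" "w 0 = 0"
proof
  define v where "v = deriv u"
  define w where "w = (\<lambda>r. v r / sqrt (1 - (v r)\<^sup>2))"
  have du: "(u has_real_derivative v r) (at r)" for r
    using assms unfolding is_solution_def v_def
    by (metis DERIV_deriv_iff_real_differentiable UNIV_I differentiable_on_def)
  have dv: "(v has_real_derivative deriv v r) (at r)" for r
    using assms unfolding is_solution_def v_def
    by (metis DERIV_deriv_iff_real_differentiable UNIV_I differentiable_on_def)
  have ode: "deriv v r / (1 - (v r)\<^sup>2) powr (3/2) = \<kappa> * u r" for r
    using assms unfolding is_solution_def v_def by blast
  have q: "1 - (v r)\<^sup>2 > 0" for r
    using assms unfolding is_solution_def v_def by (simp add: abs_square_less_1)
  have "velocity (w r) = v r" for r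
  proof -
    define s where "s = sqrt (1 - (v r)\<^sup>2)"
    have s: "s > 0" "s\<^sup>2 = 1 - (v r)\<^sup>2"
      using q[of r] by (auto simp: s_def)
    have "1 + (v r / s)\<^sup>2 = (s\<^sup>2 + (v r)\<^sup>2) / s\<^sup>2"
      using s(1) by (simp add: field_simps)
    also have "\<dots> = (1 / s)\<^sup>2"
      using s(2) by (simp add: power_one_over)
    finally have "sqrt (1 + (v r / s)\<^sup>2) = 1 / s"
      using s(1) by (simp add: real_sqrt_unique)
    then show ?thesis
      using s(1) by (simp add: velocity_def w_def s_def)
  qed
  moreover have "(w has_real_derivative \<kappa> * u r) (at r)" for r
  proof -
    define s where "s = sqrt (1 - (v r)\<^sup>2)"
    have s: "s > 0" "s\<^sup>2 = 1 - (v r)\<^sup>2"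
      using q[of r] by (auto simp: s_def)
    have "(w has_real_derivative
        (deriv v r * s - v r * ((0 - 2 * v r * deriv v r) * (inverse s / 2))) / (s * s)) (at r)"
      unfolding w_def s_def using q[of r]
      by (auto intro!: derivative_eq_intros dv simp: power2_eq_square divide_simps)
    moreover have "(deriv v r * s - v r * ((0 - 2 * v r * deriv v r) * (inverse s / 2))) / (s * s)
        = deriv v r * (s\<^sup>2 + (v r)\<^sup>2) / s ^ 3"
      using s(1) by (simp add: field_simps power2_eq_square power3_eq_cube)
    moreover have "s\<^sup>2 + (v r)\<^sup>2 = 1"
      using s(2) by simp
    moreover have "s ^ 3 = (1 - (v r)\<^sup>2) powr (3/2)"
      using q[of r] by (simp add: s_def powr_half_sqrt[symmetric] powr_powr flip: powr_realpow)
    ultimately show ?thesis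
      using ode[of r] by simp
  qed
  ultimately show "is_flow \<kappa> u w"
    using du by (simp add: is_flow_def)
  show "w 0 = 0"
    using assms by (simp add: w_def v_def is_solution_def)
qed

text \<open>
  A change of sign and a reversal of time map trajectories to trajectories.  The initial values are
  left open, so that results about a negative \<open>u\<close> carry over to a positive one.
\<close>

context
  fixes \<kappa> :: real and u w :: "real \<Rightarrow> real"
  assumes flow: "is_flow \<kappa> u w"
begin

lemma flow_DERIV_position: "(u has_real_derivative velocity (w r)) (at r)"
  and flow_DERIV_momentum: "(w has_real_derivative \<kappa> * u r) (at r)"
  using flow by (auto simp: is_flow_def)

lemma flow_continuous_on_position: "continuous_on A u"
  using flow_DERIV_position by (meson DERIV_isCont continuous_at_imp_continuous_on)

lemma flow_uminus: "is_flow \<kappa> (\<lambda>r. - u r) (\<lambda>r. - w r)"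
  unfolding is_flow_def
  by (auto intro!: derivative_eq_intros flow_DERIV_position flow_DERIV_momentum)

lemma flow_reflect: "is_flow \<kappa> (\<lambda>r. u (c - r)) (\<lambda>r. - w (c - r))"
proof -
  have "((\<lambda>r. c - r) has_real_derivative - 1) (at r)" for r
    by (auto intro!: derivative_eq_intros)
  from DERIV_chain2[OF flow_DERIV_position this] DERIV_minus[OF DERIV_chain2[OF flow_DERIV_momentum this]]
  show ?thesis
    by (simp add: is_flow_def)
qed

text \<open>
  The system is Hamiltonian with kinetic energy \<open>sqrt (1 + w\<^sup>2)\<close>, whose derivative is the velocity,
  and potential energy \<open>- \<kappa> / 2 * u\<^sup>2\<close>.
\<close>

lemma flow_energy:
  "sqrt (1 + (w r)\<^sup>2) - \<kappa> / 2 * (u r)\<^sup>2 = sqrt (1 + (w s)\<^sup>2) - \<kappa> / 2 * (u s)\<^sup>2"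
proof -
  have "((\<lambda>r. sqrt (1 + (w r)\<^sup>2) - \<kappa> / 2 * (u r)\<^sup>2) has_real_derivative 0) (at r)" for r
  proof -
    have pos: "1 + (w r)\<^sup>2 > 0"
      by (simp add: add_pos_nonneg)
    then show ?thesis
      by (auto intro!: derivative_eq_intros flow_DERIV_position flow_DERIV_momentum
          simp: velocity_def field_simps)
  qed
  then show ?thesis
    by (rule DERIV_isconst_all[rule_format])
qed

end

text \<open>
  A Gronwall estimate: the squared distance \<open>d\<close> of two trajectories in the phase plane satisfies
  \<open>\<bar>d'\<bar> \<le> (1 + \<bar>\<kappa>\<bar>) d\<close> because \<open>velocity\<close> is nonexpansive.  Hence \<open>d\<close> cannot leave the value \<open>0\<close>
  in either direction of time.
\<close>

lemma flow_unique:
  assumes 1: "is_flow \<kappa> u1 w1" and 2: "is_flow \<kappa> u2 w2"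
    and init: "u1 c = u2 c" "w1 c = w2 c"
  shows "u1 r = u2 r"
proof -
  define d where "d = (\<lambda>r. (u1 r - u2 r)\<^sup>2 + (w1 r - w2 r)\<^sup>2)"
  define d' where "d' = (\<lambda>r. 2 * (u1 r - u2 r) * (velocity (w1 r) - velocity (w2 r))
      + 2 * (w1 r - w2 r) * (\<kappa> * (u1 r - u2 r)))"
  define C where "C = 1 + \<bar>\<kappa>\<bar>"
  have dd: "(d has_real_derivative d' r) (at r)" for r
    unfolding d_def d'_def
    by (auto intro!: derivative_eq_intros flow_DERIV_position[OF 1] flow_DERIV_position[OF 2]
        flow_DERIV_momentum[OF 1] flow_DERIV_momentum[OF 2] simp: algebra_simps)
  have d'_le: "\<bar>d' r\<bar> \<le> C * d r" for r
  proof -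
    define x y where "x = \<bar>u1 r - u2 r\<bar>" and "y = \<bar>w1 r - w2 r\<bar>"
    have "\<bar>d' r\<bar> \<le> 2 * x * \<bar>velocity (w1 r) - velocity (w2 r)\<bar> + 2 * y * (\<bar>\<kappa>\<bar> * x)"
      unfolding d'_def x_def y_def by (rule order_trans[OF abs_triangle_ineq])
        (simp only: abs_mult mult.assoc abs_numeral)
    also have "\<dots> \<le> 2 * x * y + 2 * y * (\<bar>\<kappa>\<bar> * x)"
      using velocity_nonexpansive by (intro add_right_mono mult_left_mono) (auto simp: x_def y_def)
    also have "\<dots> = C * (2 * x * y)"
      by (simp add: C_def algebra_simps)
    also have "\<dots> \<le> C * (x\<^sup>2 + y\<^sup>2)"
      by (intro mult_left_mono sum_squares_bound) (simp add: C_def)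
    finally show ?thesis
      by (simp add: d_def x_def y_def)
  qed
  have "d r \<le> 0"
  proof (cases "c \<le> r")
    case True
    have "exp (- C * r) * d r \<le> exp (- C * c) * d c"
    proof (rule DERIV_nonpos_imp_nonincreasing[OF True])
      fix x
      have "((\<lambda>r. exp (- C * r) * d r) has_real_derivative exp (- C * x) * (d' x - C * d x)) (at x)"
        by (auto intro!: derivative_eq_intros dd simp: algebra_simps)
      moreover have "exp (- C * x) * (d' x - C * d x) \<le> 0"
        using d'_le[of x] by (intro mult_nonneg_nonpos) auto
      ultimately show "\<exists>y. ((\<lambda>r. exp (- C * r) * d r) has_real_derivative y) (at x) \<and> y \<le> 0"
        by blast
    qed
    then show ?thesis
      by (simp add: d_def init mult_le_0_iff)
  next
    case False
    then have "r \<le> c" by simp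
    then have "exp (C * r) * d r \<le> exp (C * c) * d c"
    proof (rule DERIV_nonneg_imp_nondecreasing)
      fix x
      have "((\<lambda>r. exp (C * r) * d r) has_real_derivative exp (C * x) * (d' x + C * d x)) (at x)"
        by (auto intro!: derivative_eq_intros dd simp: algebra_simps)
      moreover have "0 \<le> exp (C * x) * (d' x + C * d x)"
        using d'_le[of x] by (intro mult_nonneg_nonneg) auto
      ultimately show "\<exists>y. ((\<lambda>r. exp (C * r) * d r) has_real_derivative y) (at x) \<and> 0 \<le> y"
        by blast
    qed
    then show ?thesis
      by (simp add: d_def init mult_le_0_iff)
  qed
  then show ?thesis
    by (simp add: d_def sum_power2_le_zero_iff)
qed

section \<open>Symmetry and existence of a zero\<close>

text \<open>
  The trajectory \<open>r \<mapsto> (- u (2 * a - r), w (2 * a - r))\<close> agrees with \<open>(u, w)\<close> at \<open>r = a\<close>.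
\<close>

lemma flow_odd_about_zero:
  assumes "is_flow \<kappa> u w" "u a = 0"
  shows "u (2 * a - r) = - u r"
  using flow_unique[OF flow_uminus[OF flow_reflect[OF assms(1), of "2 * a"]] assms(1), of a r]
    assms(2) by simp

text \<open>
  The trajectory \<open>r \<mapsto> (u (2 * b - r), - w (2 * b - r))\<close> agrees with \<open>(u, w)\<close> at \<open>r = b\<close>.
\<close>

lemma flow_even_about_rest_point:
  assumes "is_flow \<kappa> u w" "w b = 0"
  shows "u (2 * b - r) = u r"
  using flow_unique[OF flow_reflect[OF assms(1), of "2 * b"] assms(1), of b r] assms(2) by simp

text \<open>
  If \<open>u\<close> stayed negative, \<open>w\<close> would increase from \<open>0\<close>, so from time \<open>1\<close> on \<open>u\<close> would rise at
  least at the speed \<open>c = velocity (w 1) > 0\<close>.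
\<close>

lemma flow_has_zero:
  assumes flow: "is_flow \<kappa> u w" and "\<kappa> < 0" "u 0 < 0" "w 0 = 0"
  obtains a where "a > 0" "u a = 0"
proof (rule ccontr)
  assume contr: "\<not> thesis"
  note zeroI = that
  have neg: "u r < 0" if r: "r \<ge> 0" for r
  proof (rule ccontr)
    assume "\<not> u r < 0"
    then obtain a where "0 \<le> a" "u a = 0"
      using IVT'[of u 0 0 r] \<open>u 0 < 0\<close> r flow_continuous_on_position[OF flow] by auto
    moreover from this \<open>u 0 < 0\<close> have "a \<noteq> 0"
      by auto
    ultimately show False
      using contr zeroI[of a] by simp
  qed
  have w_less: "w r < w s" if "0 \<le> r" "r < s" for r s
  proof (rule DERIV_pos_imp_increasing[OF \<open>r < s\<close>])
    fix x assume "r \<le> x"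
    then have "0 < \<kappa> * u x"
      using neg[of x] \<open>\<kappa> < 0\<close> that by (simp add: mult_neg_neg)
    then show "\<exists>y. (w has_real_derivative y) (at x) \<and> 0 < y"
      using flow_DERIV_momentum[OF flow] by blast
  qed
  define c where "c = velocity (w 1)"
  have "c > 0"
    using w_less[of 0 1] \<open>w 0 = 0\<close> by (simp add: c_def)
  \<comment> \<open>At constant speed \<open>c\<close> the value \<open>0\<close> is reached from \<open>u 1\<close> after time \<open>- u 1 / c\<close>.\<close>
  define r where "r = 1 - u 1 / c"
  have "r > 1"
    using neg[of 1] \<open>c > 0\<close> by (simp add: r_def divide_less_0_iff)
  then obtain x where x: "1 < x" "x < r" "u r - u 1 = (r - 1) * velocity (w x)"
    using MVT2[of 1 r u "\<lambda>x. velocity (w x)"] flow_DERIV_position[OF flow] by blast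
  have "c \<le> velocity (w x)"
    using strict_mono_less_eq[OF velocity_strict_mono] w_less[of 1 x] x by (simp add: c_def)
  then have "(r - 1) * c \<le> u r - u 1"
    using \<open>r > 1\<close> x(3) by (simp add: mult_left_mono)
  moreover have "(r - 1) * c = - u 1"
    using \<open>c > 0\<close> by (simp add: r_def)
  ultimately show False
    using neg[of r] \<open>r > 1\<close> by simp
qed

section \<open>Strict convexity and inflection points\<close>

text \<open>
  At \<open>p = s * x + t * y\<close> the mean value theorem on \<open>[x, p]\<close> and on \<open>[p, y]\<close> yields the convexity gap
  \<open>s * f x + t * f y - f p = s * t * (y - x) * (f' \<eta> - f' \<xi>)\<close> with \<open>\<xi> < p < \<eta>\<close>.
\<close>

lemma strictly_convex_onI:
  fixes f f' :: "real \<Rightarrow> real"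
  assumes "convex S" and deriv: "\<And>x. x \<in> S \<Longrightarrow> (f has_real_derivative f' x) (at x)"
    and mono: "strict_mono_on S f'"
  shows "strictly_convex_on S f"
  unfolding strictly_convex_on_def
proof (intro conjI ballI allI impI)
  have *: "f (s * x + t * y) < s * f x + t * f y"
    if "x \<in> S" "y \<in> S" "x < y" "0 < s" "0 < t" "s + t = 1" for x y s t :: real
  proof -
    define p where "p = s * x + t * y"
    have s: "s = 1 - t" using that by simp
    have px: "p - x = t * (y - x)" and yp: "y - p = s * (y - x)"
      unfolding p_def s by (simp_all add: algebra_simps)
    have "x < p" "p < y"
      using px yp that by (smt (verit) mult_pos_pos)+
    have sub: "{x..y} \<subseteq> S"
      using \<open>convex S\<close> that by (metis closed_segment_eq_real_ivl1 closed_segment_subset less_imp_le)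
    then have deriv': "(f has_real_derivative f' z) (at z)" if "x \<le> z" "z \<le> y" for z
      using deriv that by auto
    obtain \<xi> where \<xi>: "x < \<xi>" "\<xi> < p" "f p - f x = (p - x) * f' \<xi>"
      using MVT2[OF \<open>x < p\<close> deriv'] \<open>p < y\<close> by auto
    obtain \<eta> where \<eta>: "p < \<eta>" "\<eta> < y" "f y - f p = (y - p) * f' \<eta>"
      using MVT2[OF \<open>p < y\<close> deriv'] \<open>x < p\<close> by auto
    have "\<xi> \<in> S" "\<eta> \<in> S"
      using sub \<xi> \<eta> \<open>x < p\<close> \<open>p < y\<close> by auto
    then have "f' \<xi> < f' \<eta>"
      using mono \<xi> \<eta> by (simp add: strict_mono_on_def)
    then have "0 < s * t * (y - x) * (f' \<eta> - f' \<xi>)"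
      using that by simp
    also have "\<dots> = t * (f y - f p) - s * (f p - f x)"
      unfolding \<xi>(3) \<eta>(3) px yp by (simp add: algebra_simps)
    also have "\<dots> = s * f x + t * f y - f p"
      unfolding s by (simp add: algebra_simps)
    finally show ?thesis by (simp add: p_def)
  qed
  fix x y s t :: real
  assume "x \<in> S" "y \<in> S" "0 < s" "0 < t" "x \<noteq> y \<and> s + t = 1"
  then show "f (s * x + t * y) < s * f x + t * f y"
    using *[of x y s t] *[of y x t s] by (cases x y rule: linorder_cases) (simp_all add: add.commute)
qed fact

text \<open>
  At the midpoint of two distinct common points the two strict inequalities contradict each other.
\<close>

lemma strictly_convex_concave_disjoint:
  assumes "strictly_convex_on S f" "strictly_concave_on T f" "x \<in> S \<inter> T" "y \<in> S \<inter> T"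
  shows "x = y"
proof (rule ccontr)
  assume "x \<noteq> y"
  have "g (1/2 * x + 1/2 * y) < 1/2 * g x + 1/2 * g y"
    if "strictly_convex_on A g" "x \<in> A" "y \<in> A" for A g
    using that \<open>x \<noteq> y\<close> unfolding strictly_convex_on_def
    by (auto simp del: mult_1 times_divide_eq_left)
  from this[of S f] this[of T "\<lambda>x. - f x"] show False
    using assms by (simp add: strictly_concave_on_def)
qed

text \<open>
  Where \<open>u < 0\<close>, \<open>w' = \<kappa> u > 0\<close>, so \<open>w\<close> and with it \<open>u' = velocity w\<close> increase.
\<close>

lemma flow_strictly_convex_on:
  assumes flow: "is_flow \<kappa> u w" and "\<kappa> < 0" and "is_interval S" and neg: "\<And>x. x \<in> S \<Longrightarrow> u x < 0"
  shows "strictly_convex_on S u"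
proof (rule strictly_convex_onI[where f' = "\<lambda>x. velocity (w x)"])
  show "convex S" using \<open>is_interval S\<close> by (rule is_interval_convex)
  show "(u has_real_derivative velocity (w x)) (at x)" for x
    by (rule flow_DERIV_position[OF flow])
  show "strict_mono_on S (\<lambda>x. velocity (w x))"
  proof (rule strict_mono_onI)
    fix r s assume rs: "r \<in> S" "s \<in> S" "r < s"
    have "w r < w s"
    proof (rule DERIV_pos_imp_increasing[OF \<open>r < s\<close>])
      fix x assume "r \<le> x" "x \<le> s"
      then have "x \<in> S" using \<open>is_interval S\<close> rs mem_is_interval_1_I by blast
      then have "0 < \<kappa> * u x"
        using neg[of x] \<open>\<kappa> < 0\<close> by (simp add: mult_neg_neg)
      then show "\<exists>y. (w has_real_derivative y) (at x) \<and> 0 < y"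
        using flow_DERIV_momentum[OF flow] by blast
    qed
    then show "velocity (w r) < velocity (w s)"
      using velocity_strict_mono by (simp add: strict_mono_def)
  qed
qed

lemma flow_strictly_concave_on:
  assumes "is_flow \<kappa> u w" and "\<kappa> < 0" and "is_interval S" and "\<And>x. x \<in> S \<Longrightarrow> u x > 0"
  shows "strictly_concave_on S u"
  unfolding strictly_concave_on_def
  using assms by (intro flow_strictly_convex_on[OF flow_uminus]) auto

lemma flow_crosses_zero:
  assumes flow: "is_flow \<kappa> u w" and "u z = 0" "w z > 0"
  obtains e where "e > 0" "\<And>r. r \<in> {z - e<..<z} \<Longrightarrow> u r < 0" "\<And>r. r \<in> {z<..<z + e} \<Longrightarrow> u r > 0"
proof -
  have pos: "velocity (w z) > 0"
    using \<open>w z > 0\<close> by simp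
  obtain d1 where "d1 > 0" and right: "\<And>h. 0 < h \<Longrightarrow> h < d1 \<Longrightarrow> u z < u (z + h)"
    using DERIV_pos_inc_right[OF flow_DERIV_position[OF flow] pos] by blast
  obtain d2 where "d2 > 0" and left: "\<And>h. 0 < h \<Longrightarrow> h < d2 \<Longrightarrow> u (z - h) < u z"
    using DERIV_pos_inc_left[OF flow_DERIV_position[OF flow] pos] by blast
  have "u r < 0" if "r \<in> {z - min d1 d2<..<z}" for r
    using that \<open>u z = 0\<close> left[of "z - r"] by auto
  moreover have "u r > 0" if "r \<in> {z<..<z + min d1 d2}" for r
    using that \<open>u z = 0\<close> right[of "r - z"] by auto
  ultimately show ?thesis
    using that[of "min d1 d2"] \<open>d1 > 0\<close> \<open>d2 > 0\<close> by auto
qed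

lemma inflection_point_uminus:
  "inflection_point (\<lambda>r. - f r) x \<longleftrightarrow> inflection_point f x"
proof -
  have "isCont (\<lambda>r. - f r) x \<longleftrightarrow> isCont f x"
    using continuous_minus[of "at x" f] continuous_minus[of "at x" "\<lambda>r. - f r"] by auto
  then show ?thesis
    unfolding inflection_point_def strictly_concave_on_def by auto
qed

text \<open>
  The sign of \<open>u\<close> determines its concavity, so a change of sign is a change of concavity.
\<close>

lemma flow_inflection_point_if_rising:
  assumes flow: "is_flow \<kappa> u w" and "\<kappa> < 0" "u z = 0" "w z > 0"
  shows "inflection_point u z"
proof -
  obtain e where "e > 0" "\<And>r. r \<in> {z - e<..<z} \<Longrightarrow> u r < 0" "\<And>r. r \<in> {z<..<z + e} \<Longrightarrow> u r > 0"
    using flow_crosses_zero[OF flow] assms by blast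
  then have "strictly_convex_on {z - e<..<z} u" "strictly_concave_on {z<..<z + e} u"
    using flow_strictly_convex_on[OF flow \<open>\<kappa> < 0\<close> is_interval_oo]
      flow_strictly_concave_on[OF flow \<open>\<kappa> < 0\<close> is_interval_oo] by blast+
  then show ?thesis
    using \<open>e > 0\<close> DERIV_isCont[OF flow_DERIV_position[OF flow]]
    unfolding inflection_point_def by blast
qed

text \<open>
  By continuity \<open>u\<close> is negative, hence strictly convex, on a neighbourhood of \<open>z\<close>.  An inflection
  point would make \<open>u\<close> strictly concave on one side of \<open>z\<close>.
\<close>

lemma flow_no_inflection_if_negative:
  assumes flow: "is_flow \<kappa> u w" and "\<kappa> < 0" "u z < 0"
  shows "\<not> inflection_point u z"
proof
  assume "inflection_point u z"
  then obtain e where "e > 0" and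
    e: "strictly_concave_on {z<..<z + e} u \<or> strictly_concave_on {z - e<..<z} u"
    unfolding inflection_point_def by blast
  have "isCont u z"
    by (rule DERIV_isCont[OF flow_DERIV_position[OF flow]])
  then have "\<forall>\<^sub>F r in nhds z. u r < 0"
    using \<open>u z < 0\<close> order_tendstoD(2)[of u "u z" "nhds z" 0] isCont_def tendsto_at_iff_tendsto_nhds
    by blast
  then obtain d where "d > 0" and d: "\<And>r. dist r z < d \<Longrightarrow> u r < 0"
    unfolding eventually_nhds_metric by blast
  have conv: "strictly_convex_on {z - d<..<z + d} u"
    by (rule flow_strictly_convex_on[OF flow \<open>\<kappa> < 0\<close> is_interval_oo]) (auto intro!: d simp: dist_real_def)
  define m where "m = min d e"
  have "m > 0" "m \<le> d" "m \<le> e"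
    using \<open>d > 0\<close> \<open>e > 0\<close> by (auto simp: m_def)
  \<comment> \<open>On either side, two distinct points are needed that lie in both intervals.\<close>
  from e show False
  proof
    assume "strictly_concave_on {z<..<z + e} u"
    from strictly_convex_concave_disjoint[OF conv this, of "z + m / 2" "z + m / 3"] show False
      using \<open>m > 0\<close> \<open>m \<le> d\<close> \<open>m \<le> e\<close> by auto
  next
    assume "strictly_concave_on {z - e<..<z} u"
    from strictly_convex_concave_disjoint[OF conv this, of "z - m / 2" "z - m / 3"] show False
      using \<open>m > 0\<close> \<open>m \<le> d\<close> \<open>m \<le> e\<close> by auto
  qed
qed

text \<open>
  The cases of positive \<open>u z\<close> and of negative \<open>w z\<close> reduce to the previous lemmas for the
  trajectory \<open>(- u, - w)\<close>, as the definition of an inflection point is symmetric in convex and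
  concave.
\<close>

lemma flow_inflection_point_iff:
  assumes flow: "is_flow \<kappa> u w" and "\<kappa> < 0" and nonrest: "\<And>z. u z = 0 \<Longrightarrow> w z \<noteq> 0"
  shows "inflection_point u z \<longleftrightarrow> u z = 0"
proof
  show "u z = 0" if "inflection_point u z"
    using flow_no_inflection_if_negative[OF flow, of z]
      flow_no_inflection_if_negative[OF flow_uminus[OF flow], of z] that \<open>\<kappa> < 0\<close>
    by (cases "u z" "0 :: real" rule: linorder_cases) (simp_all add: inflection_point_uminus)
  show "inflection_point u z" if "u z = 0"
    using flow_inflection_point_if_rising[OF flow, of z]
      flow_inflection_point_if_rising[OF flow_uminus[OF flow], of z] that nonrest[of z] \<open>\<kappa> < 0\<close>
    by (cases "w z" "0 :: real" rule: linorder_cases) (simp_all add: inflection_point_uminus)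
qed

lemma flow_zeros_discrete:
  assumes flow: "is_flow \<kappa> u w" and nonrest: "\<And>z. u z = 0 \<Longrightarrow> w z \<noteq> 0"
  shows "discrete {r. u r = 0}"
proof -
  have "\<exists>e>0. \<forall>r\<in>{r. u r = 0}. dist z r < e \<longrightarrow> r = z" if "u z = 0" for z
  proof -
    obtain e where "e > 0" and "\<And>r. r \<in> {z - e<..<z} \<Longrightarrow> u r \<noteq> 0"
      "\<And>r. r \<in> {z<..<z + e} \<Longrightarrow> u r \<noteq> 0"
    proof (cases "w z > 0")
      case True
      then show ?thesis
        using flow_crosses_zero[OF flow \<open>u z = 0\<close>] that by (metis less_irrefl)
    next
      case False
      with nonrest[OF \<open>u z = 0\<close>] have "- w z > 0" by simp
      then show ?thesis
        using flow_crosses_zero[OF flow_uminus[OF flow], of z] \<open>u z = 0\<close> that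
        by (metis less_irrefl minus_zero)
    qed
    then have "u r \<noteq> 0" if "r \<noteq> z" "dist z r < e" for r
      using that by (cases "r < z") (auto simp: dist_real_def)
    then show ?thesis using \<open>e > 0\<close> by blast
  qed
  then show ?thesis
    unfolding discrete_def isolated_in_dist_Ex_iff by simp
qed

section \<open>Shape of the solution\<close>

theorem theorem6p1:
  fixes \<kappa> u0 :: real and u :: "real \<Rightarrow> real"
  assumes "\<kappa> < 0" and "u0 < 0"
    and "is_solution \<kappa> u0 u"
  shows "(\<exists>T>0. periodic_fun_simple u T)
    \<and> infinite {r. u r = 0} \<and> discrete {r. u r = 0}
    \<and> {r. inflection_point u r} = {r. u r = 0}
    \<and> (\<forall>r. u0 \<le> u r \<and> u r \<le> - u0)
    \<and> (\<exists>r. u r = u0) \<and> (\<exists>r. u r = - u0)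
    \<and> {r. u r = u0 \<or> u r = - u0} = {r. critical_point u r}"
proof -
  obtain w where flow: "is_flow \<kappa> u w" and "w 0 = 0"
    using solution_imp_flow assms(3) by blast
  have "u 0 = u0"
    using assms(3) by (simp add: is_solution_def)
  obtain a where "a > 0" "u a = 0"
    using flow_has_zero[OF flow] assms \<open>u 0 = u0\<close> \<open>w 0 = 0\<close> by blast
  have shift: "u (r + 2 * a) = - u r" for r
    using flow_odd_about_zero[OF flow \<open>u a = 0\<close>, of "- r"]
      flow_even_about_rest_point[OF flow \<open>w 0 = 0\<close>, of r] by (simp add: add.commute)
  have period: "u (r + 4 * a) = u r" for r
    using shift[of "r + 2 * a"] shift[of r] by (simp add: algebra_simps)
  interpret periodic_fun_simple u "4 * a"
    by unfold_locales (rule period)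

  have energy: "sqrt (1 + (w r)\<^sup>2) - 1 = - \<kappa> / 2 * (u0\<^sup>2 - (u r)\<^sup>2)" for r
    using flow_energy[OF flow, of r 0] \<open>u 0 = u0\<close> \<open>w 0 = 0\<close> by (simp add: algebra_simps)
  have sq_le: "(u r)\<^sup>2 \<le> u0\<^sup>2" for r
  proof -
    have "0 \<le> - \<kappa> / 2 * (u0\<^sup>2 - (u r)\<^sup>2)"
      using energy[of r, symmetric] by simp
    then show ?thesis
      using \<open>\<kappa> < 0\<close> by (simp add: mult_le_0_iff)
  qed
  have rest_iff: "w r = 0 \<longleftrightarrow> u r = u0 \<or> u r = - u0" for r
  proof -
    have "w r = 0 \<longleftrightarrow> sqrt (1 + (w r)\<^sup>2) - 1 = 0" by simp
    also have "\<dots> \<longleftrightarrow> (u r)\<^sup>2 = u0\<^sup>2"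
      unfolding energy using \<open>\<kappa> < 0\<close> by auto
    finally show ?thesis by (simp add: power2_eq_iff)
  qed
  have nonrest: "w z \<noteq> 0" if "u z = 0" for z
    using rest_iff[of z] that \<open>u0 < 0\<close> by simp

  have "infinite {r. u r = 0}"
  proof
    assume "finite {r. u r = 0}"
    moreover have "(\<lambda>n. a + of_nat n * (4 * a)) ` UNIV \<subseteq> {r. u r = 0}"
      using plus_of_nat[of a] \<open>u a = 0\<close> by auto
    moreover have "inj (\<lambda>n. a + of_nat n * (4 * a))"
      using \<open>a > 0\<close> by (auto simp: inj_def)
    ultimately show False
      using finite_subset finite_imageD infinite_UNIV_nat by blast
  qed
  moreover have "u0 \<le> u r \<and> u r \<le> - u0" for r
    using sq_le[of r] \<open>u0 < 0\<close> abs_le_square_iff[of "u r" u0] by auto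
  moreover have "\<exists>r. u r = u0" "\<exists>r. u r = - u0"
    using \<open>u 0 = u0\<close> shift[of 0] by (blast, auto)
  moreover have "\<exists>T>0. periodic_fun_simple u T"
    using periodic_fun_simple_axioms \<open>a > 0\<close> by (intro exI[of _ "4 * a"]) simp
  moreover have "critical_point u r \<longleftrightarrow> w r = 0" for r
  proof
    assume "critical_point u r"
    then have "velocity (w r) = 0"
      unfolding critical_point_def by (rule DERIV_unique[OF flow_DERIV_position[OF flow]])
    then show "w r = 0" by simp
  next
    assume "w r = 0"
    then show "critical_point u r"
      using flow_DERIV_position[OF flow, of r] by (simp add: critical_point_def)
  qed
  ultimately show ?thesis
    using flow_zeros_discrete[OF flow nonrest] flow_inflection_point_iff[OF flow \<open>\<kappa> < 0\<close> nonrest]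
    by (simp add: rest_iff)
qed

end
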